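(* Let $n\ge2$ and $r\ge0$, let $\mathscr A$ denote the space of ($C^r$) arcs $\gamma:[0,1]\to\mathbf S^n$ with the $C^r$ topology, and let $\mathscr S\subset\mathscr A$ be the subspace consisting of all $\gamma$ whose image is contained in some open hemisphere (depending on $\gamma$). Then the map $\mathscr S\to\mathbf S^n$, $\gamma\mapsto h_\gamma$, is continuous.
   Context: A point $h\in\mathbf S^n\subset\mathbf R^{n+1}$ is identified with the open hemisphere $\{p\in\mathbf S^n:\langle h,p\rangle>0\}$. For $\gamma\in\mathscr S$, let $\mathscr H\subset\mathbf S^n$ be the set of all $h\in\mathbf S^n$ such that $\langle h,\gamma(t)\rangle>0$ for all $t\in[0,1]$. This is a nonempty open, geodesically convex set contained in an open hemisphere, so its barycenter in $\mathbf R^{n+1}$ (with respect to the volume measure of $\mathbf S^n$) is not the origin; $h_\gamma\in\mathbf S^n$ denotes the image of this barycenter under the central projection $x\mapsto x/|x|$. *)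

theory Defs
  imports "HOL-Analysis.Analysis"
begin

subsection \<open>Spaces of arcs on the sphere\<close>

text \<open>The unit sphere is \<open>sphere 0 1\<close>. One-sided derivatives are taken at the end points of
  \<open>[0,1]\<close>. Since the sphere is an embedded submanifold, a map into it is of class \<open>C\<^sup>r\<close> iff it is so
  as a map into the ambient Euclidean space, and the \<open>C\<^sup>r\<close> topology is the one induced from there.\<close>

primrec arc_deriv :: "nat \<Rightarrow> (real \<Rightarrow> 'a::real_normed_vector) \<Rightarrow> real \<Rightarrow> 'a" where
  "arc_deriv 0 \<gamma> = \<gamma>"
| "arc_deriv (Suc k) \<gamma> = (\<lambda>t. vector_derivative (arc_deriv k \<gamma>) (at t within {0..1}))"

definition Cr_on_unit_interval :: "nat \<Rightarrow> (real \<Rightarrow> 'a::real_normed_vector) \<Rightarrow> bool" where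
  "Cr_on_unit_interval r \<gamma> \<longleftrightarrow>
     (\<forall>k<r. arc_deriv k \<gamma> differentiable_on {0..1}) \<and>
     (\<forall>k\<le>r. continuous_on {0..1} (arc_deriv k \<gamma>))"

text \<open>Arcs are extensional functions (\<open>undefined\<close> off \<open>[0,1]\<close>), so that equality of arcs is
  equality on \<open>[0,1]\<close>.\<close>

definition sphere_arcs :: "nat \<Rightarrow> (real \<Rightarrow> 'a::euclidean_space) set" where
  "sphere_arcs r = {\<gamma> \<in> {0..1} \<rightarrow>\<^sub>E sphere 0 1. Cr_on_unit_interval r \<gamma>}"

text \<open>The topology of the metric
  \<open>max\<^bsub>k \<le> r\<^esub> sup\<^bsub>t \<in> [0,1]\<^esub> |\<gamma>\<^bsup>(k)\<^esup>(t) - \<eta>\<^bsup>(k)\<^esup>(t)|\<close>.\<close>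

definition Cr_topology :: "nat \<Rightarrow> (real \<Rightarrow> 'a::euclidean_space) topology" where
  "Cr_topology r = topology (\<lambda>U. U \<subseteq> sphere_arcs r \<and>
     (\<forall>\<gamma>\<in>U. \<exists>e>0. \<forall>\<eta>\<in>sphere_arcs r.
        (\<forall>k\<le>r. \<forall>t\<in>{0..1}. dist (arc_deriv k \<gamma> t) (arc_deriv k \<eta> t) < e) \<longrightarrow> \<eta> \<in> U))"

lemma openin_Cr_topology:
  fixes U :: "(real \<Rightarrow> 'a::euclidean_space) set"
  shows "openin (Cr_topology r) U \<longleftrightarrow> U \<subseteq> sphere_arcs r \<and>
     (\<forall>\<gamma>\<in>U. \<exists>e>0. \<forall>\<eta>\<in>sphere_arcs r.
        (\<forall>k\<le>r. \<forall>t\<in>{0..1}. dist (arc_deriv k \<gamma> t) (arc_deriv k \<eta> t) < e) \<longrightarrow> \<eta> \<in> U)"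
proof -
  define P where "P = (\<lambda>U :: (real \<Rightarrow> 'a) set. U \<subseteq> sphere_arcs r \<and>
     (\<forall>\<gamma>\<in>U. \<exists>e>0. \<forall>\<eta>\<in>sphere_arcs r.
        (\<forall>k\<le>r. \<forall>t\<in>{0..1}. dist (arc_deriv k \<gamma> t) (arc_deriv k \<eta> t) < e) \<longrightarrow> \<eta> \<in> U))"
  have "P (S \<inter> T)" if S: "P S" and T: "P T" for S T
    unfolding P_def
  proof (intro conjI ballI)
    show "S \<inter> T \<subseteq> sphere_arcs r" using S by (auto simp: P_def)
    fix \<gamma> assume \<gamma>: "\<gamma> \<in> S \<inter> T"
    obtain a where a: "a > 0" "\<forall>\<eta>\<in>sphere_arcs r.
        (\<forall>k\<le>r. \<forall>t\<in>{0..1}. dist (arc_deriv k \<gamma> t) (arc_deriv k \<eta> t) < a) \<longrightarrow> \<eta> \<in> S"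
      using S \<gamma> unfolding P_def by blast
    obtain b where b: "b > 0" "\<forall>\<eta>\<in>sphere_arcs r.
        (\<forall>k\<le>r. \<forall>t\<in>{0..1}. dist (arc_deriv k \<gamma> t) (arc_deriv k \<eta> t) < b) \<longrightarrow> \<eta> \<in> T"
      using T \<gamma> unfolding P_def by blast
    show "\<exists>e>0. \<forall>\<eta>\<in>sphere_arcs r.
        (\<forall>k\<le>r. \<forall>t\<in>{0..1}. dist (arc_deriv k \<gamma> t) (arc_deriv k \<eta> t) < e) \<longrightarrow> \<eta> \<in> S \<inter> T"
      using a b by (intro exI[of _ "min a b"]) simp
  qed
  moreover have "P (\<Union>K)" if K: "\<forall>S\<in>K. P S" for K
    unfolding P_def
  proof (intro conjI ballI)
    show "\<Union>K \<subseteq> sphere_arcs r" using K by (auto simp: P_def)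
    fix \<gamma> assume "\<gamma> \<in> \<Union>K"
    then obtain S where S: "S \<in> K" "\<gamma> \<in> S" by blast
    then obtain a where "a > 0" "\<forall>\<eta>\<in>sphere_arcs r.
        (\<forall>k\<le>r. \<forall>t\<in>{0..1}. dist (arc_deriv k \<gamma> t) (arc_deriv k \<eta> t) < a) \<longrightarrow> \<eta> \<in> S"
      using K unfolding P_def by blast
    with S show "\<exists>e>0. \<forall>\<eta>\<in>sphere_arcs r.
        (\<forall>k\<le>r. \<forall>t\<in>{0..1}. dist (arc_deriv k \<gamma> t) (arc_deriv k \<eta> t) < e) \<longrightarrow> \<eta> \<in> \<Union>K"
      by blast
  qed
  ultimately have "istopology P" unfolding istopology_def by blast
  then have "openin (topology P) U \<longleftrightarrow> P U" by (simp add: topology_inverse')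
  then show ?thesis unfolding Cr_topology_def P_def .
qed

lemma topspace_Cr_topology [simp]: "topspace (Cr_topology r) = sphere_arcs r"
proof -
  have "openin (Cr_topology r) (sphere_arcs r :: (real \<Rightarrow> 'a) set)"
    unfolding openin_Cr_topology using zero_less_one by blast
  then show ?thesis
    by (metis openin_Cr_topology openin_subset openin_topspace subset_antisym)
qed

definition open_hemisphere :: "'a::euclidean_space \<Rightarrow> 'a set" where
  "open_hemisphere h = {p \<in> sphere 0 1. h \<bullet> p > 0}"

definition hemispherical_arcs :: "nat \<Rightarrow> (real \<Rightarrow> 'a::euclidean_space) set" where
  "hemispherical_arcs r =
     {\<gamma> \<in> sphere_arcs r. \<exists>h \<in> sphere 0 1. \<gamma> ` {0..1} \<subseteq> open_hemisphere h}"

subsection \<open>The barycenter of the containing hemispheres\<close>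

text \<open>The volume measure of the unit sphere in a \<open>d\<close>-dimensional Euclidean space: the surface factor
  of Lebesgue measure in polar coordinates, i.e. \<open>d\<close> times the Lebesgue measure of the truncated
  cone over a set (see \<open>emeasure_sphere_volume\<close> below); the factor normalises the radial integral
  of \<open>t\<^bsup>d-1\<^esup>\<close> over \<open>(0,1)\<close>.\<close>

definition sphere_volume :: "'a::euclidean_space measure" where
  "sphere_volume = scale_measure (of_nat DIM('a))
     (distr (restrict_space lborel (ball 0 1 - {0})) (restrict_space borel (sphere 0 1))
       (\<lambda>x. x /\<^sub>R norm x))"

lemma space_sphere_volume [simp]: "space sphere_volume = sphere 0 1"
  by (simp add: sphere_volume_def space_scale_measure space_restrict_space)

lemma sets_sphere_volume [measurable_cong]:
  "sets sphere_volume = sets (restrict_space borel (sphere 0 1))"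
  by (simp add: sphere_volume_def)

lemma emeasure_sphere_volume:
  fixes A :: "'a::euclidean_space set"
  assumes "A \<in> sets borel" "A \<subseteq> sphere 0 1"
  shows "emeasure sphere_volume A
     = of_nat DIM('a) * emeasure lborel {t *\<^sub>R p | t p. 0 < t \<and> t < 1 \<and> p \<in> A}"
proof -
  let ?B = "ball 0 1 - {0} :: 'a set"
  let ?C = "{t *\<^sub>R p | t p. 0 < t \<and> t < 1 \<and> p \<in> A}"
  have meas: "(\<lambda>x. x /\<^sub>R norm x) \<in> restrict_space lborel ?B \<rightarrow>\<^sub>M restrict_space borel (sphere 0 1)"
  proof (rule measurable_restrict_space2)
    show "(\<lambda>x. x /\<^sub>R norm x) \<in> space (restrict_space lborel ?B) \<rightarrow> sphere 0 1"
      by (auto simp: space_restrict_space)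
    have "(\<lambda>x::'a. x /\<^sub>R norm x) \<in> borel_measurable lborel" by measurable
    then show "(\<lambda>x. x /\<^sub>R norm x) \<in> borel_measurable (restrict_space lborel ?B)"
      by (rule measurable_restrict_space1)
  qed
  have A: "A \<in> sets (restrict_space borel (sphere 0 1))"
    using assms by (simp add: sets_restrict_space_iff)
  have eq: "(\<lambda>x. x /\<^sub>R norm x) -` A \<inter> ?B = ?C"
  proof (intro equalityI subsetI)
    fix x assume x: "x \<in> (\<lambda>x. x /\<^sub>R norm x) -` A \<inter> ?B"
    then have "x = norm x *\<^sub>R (x /\<^sub>R norm x)" by simp
    with x show "x \<in> ?C"
      by (intro CollectI exI[of _ "norm x"] exI[of _ "x /\<^sub>R norm x"]) auto
  next
    fix x assume "x \<in> ?C"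
    then obtain t p where tp: "x = t *\<^sub>R p" "0 < t" "t < 1" "p \<in> A" by blast
    moreover from tp(4) assms(2) have "norm p = 1" by auto
    ultimately show "x \<in> (\<lambda>x. x /\<^sub>R norm x) -` A \<inter> ?B" by auto
  qed
  have "?C \<subseteq> ?B" using eq by blast
  then have "emeasure (restrict_space lborel ?B) ?C = emeasure lborel ?C"
    by (intro emeasure_restrict_space) auto
  then show ?thesis
    unfolding sphere_volume_def emeasure_scale_measure emeasure_distr[OF meas A]
    by (simp add: space_restrict_space eq)
qed

definition barycenter :: "'a::euclidean_space measure \<Rightarrow> 'a set \<Rightarrow> 'a" where
  "barycenter M A = (LINT x:A|M. x) /\<^sub>R measure M A"

definition hemispheres_containing :: "(real \<Rightarrow> 'a::euclidean_space) \<Rightarrow> 'a set" where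
  "hemispheres_containing \<gamma> = {h \<in> sphere 0 1. \<forall>t\<in>{0..1}. h \<bullet> \<gamma> t > 0}"

definition central_hemisphere :: "(real \<Rightarrow> 'a::euclidean_space) \<Rightarrow> 'a" where
  "central_hemisphere \<gamma> =
     (let b = barycenter sphere_volume (hemispheres_containing \<gamma>) in b /\<^sub>R norm b)"

end

theory Submission
  imports Defs
begin

text \<open>Up to a positive factor, the barycenter is the integral \<open>F \<gamma>\<close> of the identity over the set
  \<open>H\<close> of hemispheres containing \<open>\<gamma>\<close>. It is nonzero because \<open>F \<gamma> \<bullet> \<gamma> 0\<close> integrates a positive
  function over a set of positive measure. If arcs \<open>\<eta>\<^sub>k\<close> converge uniformly to \<open>\<gamma>\<close>, the
  indicator functions of the corresponding sets converge at every point outside the boundary of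
  \<open>H\<close>. That boundary lies in the frontier of the convex cone dual to \<open>\<gamma>\<close>, hence is a null set,
  and \<open>F\<close> is continuous by dominated convergence.\<close>

section \<open>Dual cones of an arc in the ambient space\<close>

definition dual_cone :: "(real \<Rightarrow> 'a::euclidean_space) \<Rightarrow> 'a set" where
  "dual_cone \<gamma> = {x. \<forall>t\<in>{0..1}. x \<bullet> \<gamma> t \<ge> 0}"

text \<open>Both cones are taken in the whole space rather than on the sphere, so that facts on
  convex sets and on Lebesgue measure apply to them and to their difference.\<close>

definition strict_dual_cone :: "(real \<Rightarrow> 'a::euclidean_space) \<Rightarrow> 'a set" where
  "strict_dual_cone \<gamma> = {x. \<forall>t\<in>{0..1}. x \<bullet> \<gamma> t > 0}"

lemma hemispheres_containing_eq: "hemispheres_containing \<gamma> = sphere 0 1 \<inter> strict_dual_cone \<gamma>"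
  by (auto simp: hemispheres_containing_def strict_dual_cone_def)

lemma dual_cone_eq_Inter: "dual_cone \<gamma> = (\<Inter>t\<in>{0..1}. {x. x \<bullet> \<gamma> t \<ge> 0})"
  by (auto simp: dual_cone_def)

lemma closed_dual_cone: "closed (dual_cone \<gamma>)"
  unfolding dual_cone_eq_Inter
  by (intro closed_INT ballI closed_Collect_le continuous_intros)

lemma convex_dual_cone: "convex (dual_cone \<gamma>)"
  unfolding dual_cone_eq_Inter
  by (intro convex_INT) (simp add: convex_halfspace_ge inner_commute[of _ "\<gamma> _"])

text \<open>Compactness of the interval: the continuous function
  \<open>x \<bullet> \<gamma> t\<close> attains its minimum, which is positive. This uniform margin
  tolerates small changes of \<open>x\<close> as well as of the arc.\<close>

lemma strict_dual_cone_lower_bound: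
  fixes \<gamma> :: "real \<Rightarrow> 'a::euclidean_space"
  assumes "continuous_on {0..1} \<gamma>" "x \<in> strict_dual_cone \<gamma>"
  obtains m where "m > 0" "\<And>t. t \<in> {0..1} \<Longrightarrow> m \<le> x \<bullet> \<gamma> t"
proof -
  have "continuous_on {0..1} (\<lambda>t. x \<bullet> \<gamma> t)"
    by (intro continuous_intros assms)
  then have "\<exists>s\<in>{0..1}. \<forall>t\<in>{0..1}. x \<bullet> \<gamma> s \<le> x \<bullet> \<gamma> t"
    by (intro continuous_attains_inf) auto
  then obtain s where s: "s \<in> {0..1}" "\<forall>t\<in>{0..1}. x \<bullet> \<gamma> s \<le> x \<bullet> \<gamma> t"
    by blast
  with assms(2) show ?thesis
    by (intro that[of "x \<bullet> \<gamma> s"]) (auto simp: strict_dual_cone_def)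
qed

text \<open>By Cauchy-Schwarz with unit vectors, moving \<open>x\<close> by less than its margin
  \<open>m\<close> changes every inner product by less than \<open>m\<close>.\<close>

lemma open_strict_dual_cone:
  fixes \<gamma> :: "real \<Rightarrow> 'a::euclidean_space"
  assumes "continuous_on {0..1} \<gamma>" and norm: "\<And>t. t \<in> {0..1} \<Longrightarrow> norm (\<gamma> t) = 1"
  shows "open (strict_dual_cone \<gamma>)"
  unfolding open_dist
proof
  fix x assume "x \<in> strict_dual_cone \<gamma>"
  then obtain m where m: "m > 0" "\<And>t. t \<in> {0..1} \<Longrightarrow> m \<le> x \<bullet> \<gamma> t"
    using strict_dual_cone_lower_bound[OF assms(1)] by blast
  have "y \<in> strict_dual_cone \<gamma>" if "dist y x < m" for y
    unfolding strict_dual_cone_def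
  proof (intro CollectI ballI)
    fix t :: real assume t: "t \<in> {0..1}"
    have "\<bar>(x - y) \<bullet> \<gamma> t\<bar> < m"
      using Cauchy_Schwarz_ineq2[of "x - y" "\<gamma> t"] norm[OF t] that
      by (simp add: dist_norm norm_minus_commute)
    with m(2)[OF t] show "y \<bullet> \<gamma> t > 0"
      by (simp add: inner_diff_left)
  qed
  with m(1) show "\<exists>e>0. \<forall>y. dist y x < e \<longrightarrow> y \<in> strict_dual_cone \<gamma>" by blast
qed

text \<open>Where \<open>x \<bullet> \<gamma> t\<close> vanishes, an arbitrarily small step in the
  direction \<open>- \<gamma> t\<close> leaves the closed cone. The point of the inclusion is that
  frontiers of convex sets are negligible.\<close>

lemma dual_cone_boundary_subset_frontier:
  fixes \<gamma> :: "real \<Rightarrow> 'a::euclidean_space"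
  assumes norm: "\<And>t. t \<in> {0..1} \<Longrightarrow> norm (\<gamma> t) = 1"
  shows "dual_cone \<gamma> - strict_dual_cone \<gamma> \<subseteq> frontier (dual_cone \<gamma>)"
proof
  fix x assume x: "x \<in> dual_cone \<gamma> - strict_dual_cone \<gamma>"
  then obtain t where t: "t \<in> {0..1}" "x \<bullet> \<gamma> t = 0"
    by (force simp: dual_cone_def strict_dual_cone_def)
  have "\<exists>y. y \<notin> dual_cone \<gamma> \<and> dist x y < e" if e: "e > 0" for e
  proof (intro exI conjI)
    \<comment> \<open>The step has length \<open>e / 2\<close>, and the new inner product with the
      unit vector \<open>\<gamma> t\<close> is \<open>- e / 2\<close>.\<close>
    have "(x - (e / 2) *\<^sub>R \<gamma> t) \<bullet> \<gamma> t < 0"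
      using t e norm[OF t(1)] by (simp add: inner_diff_left dot_square_norm)
    with t(1) show "x - (e / 2) *\<^sub>R \<gamma> t \<notin> dual_cone \<gamma>"
      unfolding dual_cone_def using not_le by blast
    show "dist x (x - (e / 2) *\<^sub>R \<gamma> t) < e"
      using e norm[OF t(1)] by (simp add: dist_norm)
  qed
  with x show "x \<in> frontier (dual_cone \<gamma>)"
    unfolding frontier_straddle by (metis DiffD1 dist_self)
qed

section \<open>Spherical volume of the set of hemispheres and of its boundary\<close>

lemma finite_measure_sphere_volume: "finite_measure (sphere_volume :: 'a::euclidean_space measure)"
proof
  have "{t *\<^sub>R p |t p. 0 < t \<and> t < 1 \<and> p \<in> sphere (0::'a) 1} \<subseteq> ball 0 1" (is "?C \<subseteq> _")
    by auto
  then have "emeasure lborel ?C \<le> emeasure lborel (ball (0::'a) 1)"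
    by (intro emeasure_mono) auto
  also have "\<dots> < \<infinity>"
    by (intro emeasure_bounded_finite bounded_ball)
  finally show "emeasure (sphere_volume :: 'a measure) (space sphere_volume) \<noteq> \<infinity>"
    by (simp add: emeasure_sphere_volume ennreal_mult_eq_top_iff)
qed

text \<open>The strict cone is invariant under positive scaling. This turns the spherical volume of
  the hemispheres into the Lebesgue measure of an open set.\<close>

lemma cone_over_hemispheres_containing:
  fixes \<gamma> :: "real \<Rightarrow> 'a::euclidean_space"
  shows "{t *\<^sub>R p |t p. 0 < t \<and> t < 1 \<and> p \<in> hemispheres_containing \<gamma>}
         = ball 0 1 \<inter> strict_dual_cone \<gamma>" (is "?L = ?R")
proof (intro equalityI subsetI)
  fix x assume "x \<in> ?L"
  then show "x \<in> ?R" by (auto simp: hemispheres_containing_def strict_dual_cone_def)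
next
  fix x assume x: "x \<in> ?R"
  \<comment> \<open>Testing at parameter 0 excludes the origin, so that \<open>x\<close> can be
    normalised.\<close>
  then have "x \<bullet> \<gamma> 0 > 0" by (simp add: strict_dual_cone_def)
  then have "x \<noteq> 0" by auto
  with x show "x \<in> ?L"
    by (intro CollectI exI[of _ "norm x"] exI[of _ "x /\<^sub>R norm x"])
       (auto simp: hemispheres_containing_def strict_dual_cone_def)
qed

lemma borel_hemispheres_containing:
  fixes \<gamma> :: "real \<Rightarrow> 'a::euclidean_space"
  assumes "continuous_on {0..1} \<gamma>" "\<And>t. t \<in> {0..1} \<Longrightarrow> norm (\<gamma> t) = 1"
  shows "hemispheres_containing \<gamma> \<in> sets borel"
  unfolding hemispheres_containing_eq
  by (intro sets.Int borel_closed borel_open closed_sphere open_strict_dual_cone assms)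

lemma sets_hemispheres_containing:
  fixes \<gamma> :: "real \<Rightarrow> 'a::euclidean_space"
  assumes "continuous_on {0..1} \<gamma>" "\<And>t. t \<in> {0..1} \<Longrightarrow> norm (\<gamma> t) = 1"
  shows "hemispheres_containing \<gamma> \<in> sets sphere_volume"
  using borel_hemispheres_containing[OF assms]
  by (simp add: sets_sphere_volume sets_restrict_space_iff hemispheres_containing_eq)

text \<open>The truncated cone is open and nonempty, hence has positive Lebesgue measure.\<close>

lemma emeasure_hemispheres_containing_pos:
  fixes \<gamma> :: "real \<Rightarrow> 'a::euclidean_space"
  assumes "continuous_on {0..1} \<gamma>" "\<And>t. t \<in> {0..1} \<Longrightarrow> norm (\<gamma> t) = 1"
    and "hemispheres_containing \<gamma> \<noteq> {}"
  shows "emeasure sphere_volume (hemispheres_containing \<gamma>) > 0"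
proof -
  let ?C = "ball 0 1 \<inter> strict_dual_cone \<gamma>"
  have "open ?C" by (intro open_Int open_ball open_strict_dual_cone assms)
  moreover have "?C \<noteq> {}"
  proof -
    obtain p where "p \<in> hemispheres_containing \<gamma>" using assms(3) by blast
    \<comment> \<open>The unit vector \<open>p\<close> lies outside the open ball; halving it gives
      a point of the truncated cone.\<close>
    then have "(1/2) *\<^sub>R p \<in> ?C"
      unfolding cone_over_hemispheres_containing[symmetric]
      by (intro CollectI exI[of _ "1/2"] exI[of _ p]) auto
    then show ?thesis by blast
  qed
  ultimately have "emeasure lborel ?C \<noteq> 0"
    using open_not_negligible[of ?C] negligible_iff_null_sets null_sets_completionI
    by (metis borel_open null_setsI sets_lborel)
  moreover have "hemispheres_containing \<gamma> \<subseteq> sphere 0 1"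
    by (simp add: hemispheres_containing_eq)
  then have "emeasure sphere_volume (hemispheres_containing \<gamma>)
      = of_nat DIM('a) * emeasure lborel ?C"
    using emeasure_sphere_volume[OF borel_hemispheres_containing[OF assms(1,2)]]
    by (simp only: cone_over_hemispheres_containing)
  ultimately show ?thesis
    by (simp add: ennreal_zero_less_mult_iff zero_less_iff_neq_zero)
qed

text \<open>Both cones are invariant under positive scaling, so the truncated cone over the
  spherical boundary stays in the frontier of a convex set and is Lebesgue null.\<close>

lemma AE_not_boundary_dual_cone:
  fixes \<gamma> :: "real \<Rightarrow> 'a::euclidean_space"
  assumes "continuous_on {0..1} \<gamma>" "\<And>t. t \<in> {0..1} \<Longrightarrow> norm (\<gamma> t) = 1"
  shows "AE x in sphere_volume. x \<notin> dual_cone \<gamma> - strict_dual_cone \<gamma>"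
proof -
  let ?Z = "sphere 0 1 \<inter> (dual_cone \<gamma> - strict_dual_cone \<gamma>)"
  let ?C = "{t *\<^sub>R p |t p. 0 < t \<and> t < 1 \<and> p \<in> ?Z}"
  have Z: "?Z \<in> sets borel"
    by (intro sets.Int sets.Diff borel_closed closed_dual_cone closed_sphere
          borel_open open_strict_dual_cone assms)
  have "?C \<subseteq> dual_cone \<gamma> - strict_dual_cone \<gamma>"
    by (auto simp: dual_cone_def strict_dual_cone_def zero_less_mult_iff)
  then have "?C \<subseteq> frontier (dual_cone \<gamma>)"
    using dual_cone_boundary_subset_frontier[of \<gamma>] assms(2) by blast
  moreover have "emeasure lborel (frontier (dual_cone \<gamma>)) = 0"
  proof -
    \<comment> \<open>Negligibility concerns the completed measure; it is then carried over to
      \<open>lborel\<close>.\<close>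
    have "frontier (dual_cone \<gamma>) \<in> null_sets lebesgue"
      using negligible_convex_frontier[OF convex_dual_cone[of \<gamma>]] by (simp add: negligible_iff_null_sets)
    then show ?thesis
      by (simp add: null_sets_def main_part_null_part_Un emeasure_completion)
  qed
  ultimately have "emeasure lborel ?C = 0"
    using emeasure_mono[of ?C "frontier (dual_cone \<gamma>)" lborel] by (simp add: frontier_closed)
  then have "emeasure sphere_volume ?Z = 0"
    using emeasure_sphere_volume[OF Z] by simp
  moreover have "?Z \<in> sets sphere_volume"
    using Z by (simp add: sets_sphere_volume sets_restrict_space_iff)
  ultimately have "?Z \<in> null_sets sphere_volume" by blast
  \<comment> \<open>Points of the measure space lie on the sphere, so avoiding \<open>?Z\<close>
    there means avoiding the whole boundary.\<close>
  from AE_not_in[OF this] show ?thesis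
    by (rule AE_mp) (auto intro!: AE_I2)
qed

section \<open>Convergence of the integrals under uniform convergence of arcs\<close>

lemma set_integrable_id_hemispheres_containing:
  fixes \<gamma> :: "real \<Rightarrow> 'a::euclidean_space"
  assumes "continuous_on {0..1} \<gamma>" "\<And>t. t \<in> {0..1} \<Longrightarrow> norm (\<gamma> t) = 1"
  shows "set_integrable sphere_volume (hemispheres_containing \<gamma>) (\<lambda>x. x)"
proof -
  interpret finite_measure "sphere_volume :: 'a measure" by (rule finite_measure_sphere_volume)
  have "(\<lambda>x::'a. x) \<in> borel_measurable sphere_volume"
    by (simp add: measurable_cong_sets[OF sets_sphere_volume refl] measurable_restrict_space1)
  then show ?thesis
    unfolding set_integrable_def using sets_hemispheres_containing[OF assms]
    by (intro integrable_const_bound[where B = 1])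
       (auto simp: indicator_def)
qed

text \<open>Once the arcs differ by less than the margin of \<open>x\<close>, all inner products
  stay positive simultaneously; this step relies on uniformity in \<open>t\<close>.\<close>

lemma eventually_mem_hemispheres_containing:
  fixes \<gamma> :: "real \<Rightarrow> 'a::euclidean_space"
  assumes "continuous_on {0..1} \<gamma>" "x \<in> hemispheres_containing \<gamma>"
    and lim: "uniform_limit {0..1} \<eta> \<gamma> F"
  shows "\<forall>\<^sub>F k in F. x \<in> hemispheres_containing (\<eta> k)"
proof -
  have x: "norm x = 1" "x \<in> strict_dual_cone \<gamma>"
    using assms(2) by (auto simp: hemispheres_containing_eq)
  obtain m where m: "m > 0" "\<And>t. t \<in> {0..1} \<Longrightarrow> m \<le> x \<bullet> \<gamma> t"
    using strict_dual_cone_lower_bound[OF assms(1) x(2)] by blast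
  from uniform_limitD[OF lim m(1)] show ?thesis
  proof eventually_elim
    case (elim k)
    have "x \<bullet> \<eta> k t > 0" if t: "t \<in> {0..1}" for t
    proof -
      have "\<bar>x \<bullet> (\<eta> k t - \<gamma> t)\<bar> < m"
        using Cauchy_Schwarz_ineq2[of x "\<eta> k t - \<gamma> t"] elim t x(1) by (force simp: dist_norm)
      with m(2)[OF t] show ?thesis by (simp add: inner_diff_right)
    qed
    with x(1) show ?case by (simp add: hemispheres_containing_def)
  qed
qed

text \<open>A single parameter with negative inner product is a witness, and convergence at that
  parameter preserves the sign.\<close>

lemma eventually_not_mem_hemispheres_containing:
  fixes \<gamma> :: "real \<Rightarrow> 'a::euclidean_space"
  assumes "x \<notin> dual_cone \<gamma>" and lim: "uniform_limit {0..1} \<eta> \<gamma> F"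
  shows "\<forall>\<^sub>F k in F. x \<notin> hemispheres_containing (\<eta> k)"
proof -
  obtain t where t: "t \<in> {0..1}" "x \<bullet> \<gamma> t < 0"
    using assms(1) by (auto simp: dual_cone_def not_le)
  have "((\<lambda>k. x \<bullet> \<eta> k t) \<longlongrightarrow> x \<bullet> \<gamma> t) F"
    by (intro tendsto_intros tendsto_uniform_limitI[OF lim t(1)])
  from order_tendstoD(2)[OF this t(2)] show ?thesis
    by eventually_elim (use t(1) in \<open>force simp: hemispheres_containing_def\<close>)
qed

lemma tendsto_integral_hemispheres_containing:
  fixes \<gamma> :: "real \<Rightarrow> 'a::euclidean_space"
  assumes \<gamma>: "continuous_on {0..1} \<gamma>" "\<And>t. t \<in> {0..1} \<Longrightarrow> norm (\<gamma> t) = 1"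
    and \<eta>: "\<And>k. continuous_on {0..1} (\<eta> k)" "\<And>k t. t \<in> {0..1} \<Longrightarrow> norm (\<eta> k t) = 1"
    and lim: "uniform_limit {0..1} \<eta> \<gamma> sequentially"
  shows "(\<lambda>k. LINT x:hemispheres_containing (\<eta> k)|sphere_volume. x)
           \<longlonglongrightarrow> (LINT x:hemispheres_containing \<gamma>|sphere_volume. x)"
  unfolding set_lebesgue_integral_def
\<comment> \<open>The constant 1 dominates because points of the sphere have norm 1, and it is
  integrable because the measure is finite.\<close>
proof (rule integral_dominated_convergence[where w = "\<lambda>_. 1"])
  interpret finite_measure "sphere_volume :: 'a measure" by (rule finite_measure_sphere_volume)
  show "integrable (sphere_volume :: 'a measure) (\<lambda>_. 1 :: real)" by simp
  show "(\<lambda>x. indicator (hemispheres_containing \<gamma>) x *\<^sub>R x) \<in> borel_measurable sphere_volume"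
    using set_integrable_id_hemispheres_containing[OF \<gamma>]
    by (auto simp: set_integrable_def)
  show "(\<lambda>x. indicator (hemispheres_containing (\<eta> k)) x *\<^sub>R x) \<in> borel_measurable sphere_volume" for k
    using set_integrable_id_hemispheres_containing[OF \<eta>]
    by (auto simp: set_integrable_def)
  show "AE x in sphere_volume. norm (indicator (hemispheres_containing (\<eta> k)) x *\<^sub>R x) \<le> 1" for k
    by (intro AE_I2) (auto simp: indicator_def)
  have pointwise: "(\<lambda>k. indicator (hemispheres_containing (\<eta> k)) x *\<^sub>R x)
           \<longlonglongrightarrow> indicator (hemispheres_containing \<gamma>) x *\<^sub>R x"
    if x: "x \<in> sphere 0 1" "x \<notin> dual_cone \<gamma> - strict_dual_cone \<gamma>" for x
  \<comment> \<open>Off the boundary the indicators are eventually constant in \<open>k\<close>, so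
    the limit is an eventual equality.\<close>
  proof (rule tendsto_eventually)
    show "\<forall>\<^sub>F k in sequentially. indicator (hemispheres_containing (\<eta> k)) x *\<^sub>R x
            = indicator (hemispheres_containing \<gamma>) x *\<^sub>R x"
    proof (cases "x \<in> hemispheres_containing \<gamma>")
      case True
      from eventually_mem_hemispheres_containing[OF \<gamma>(1) True lim] show ?thesis
        by eventually_elim (simp add: True)
    next
      case False
      with x have "x \<notin> dual_cone \<gamma>" by (auto simp: hemispheres_containing_eq)
      from eventually_not_mem_hemispheres_containing[OF this lim] show ?thesis
        by eventually_elim (simp add: False)
    qed
  qed
  have "AE x in sphere_volume. x \<notin> dual_cone \<gamma> - strict_dual_cone \<gamma>"
    by (rule AE_not_boundary_dual_cone[OF \<gamma>])
  with AE_space show "AE x in sphere_volume. (\<lambda>k. indicator (hemispheres_containing (\<eta> k)) x *\<^sub>R x)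
           \<longlonglongrightarrow> indicator (hemispheres_containing \<gamma>) x *\<^sub>R x"
    by eventually_elim (rule pointwise, unfold space_sphere_volume)
qed

section \<open>Nonvanishing and normalisation of the integral\<close>

lemma integral_hemispheres_containing_nonzero:
  fixes \<gamma> :: "real \<Rightarrow> 'a::euclidean_space"
  assumes \<gamma>: "continuous_on {0..1} \<gamma>" "\<And>t. t \<in> {0..1} \<Longrightarrow> norm (\<gamma> t) = 1"
    and ne: "hemispheres_containing \<gamma> \<noteq> {}"
  shows "(LINT x:hemispheres_containing \<gamma>|sphere_volume. x) \<noteq> 0"
proof
  let ?H = "hemispheres_containing \<gamma>"
  let ?f = "\<lambda>x. (indicator ?H x *\<^sub>R x) \<bullet> \<gamma> 0"
  assume zero: "(LINT x:?H|sphere_volume. x) = 0"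
  have int: "integrable sphere_volume (\<lambda>x. indicator ?H x *\<^sub>R x)"
    using set_integrable_id_hemispheres_containing[OF \<gamma>] by (simp add: set_integrable_def)
  have "(LINT x|sphere_volume. ?f x) = 0"
    using integral_inner_left[OF int, of "\<gamma> 0"] zero
    by (simp add: set_lebesgue_integral_def)
  moreover have "AE x in sphere_volume. 0 \<le> ?f x"
    by (intro AE_I2) (auto simp: indicator_def hemispheres_containing_def less_imp_le)
  moreover have "integrable sphere_volume ?f"
    using int by (rule integrable_inner_left)
  \<comment> \<open>A nonnegative function with zero integral vanishes almost everywhere. As
    \<open>?f\<close> is positive on \<open>?H\<close>, this makes \<open>?H\<close> a null set,
    against its positive volume.\<close>
  ultimately have "AE x in sphere_volume. ?f x = 0"
    by (subst (asm) integral_nonneg_eq_0_iff_AE) auto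
  moreover have "x \<bullet> \<gamma> 0 > 0" if "x \<in> ?H" for x
    using that by (simp add: hemispheres_containing_def)
  then have "?f x = 0 \<longrightarrow> x \<notin> ?H" for x
    by (metis indicator_simps(1) less_irrefl scaleR_one)
  ultimately have "AE x in sphere_volume. x \<notin> ?H"
    by (rule AE_mp[OF _ AE_I2])
  then have "emeasure sphere_volume ?H = 0"
    using AE_iff_measurable[OF sets_hemispheres_containing[OF \<gamma>], of "\<lambda>x. x \<notin> ?H"]
    by (auto simp: hemispheres_containing_def)
  with emeasure_hemispheres_containing_pos[OF \<gamma> ne] show False by simp
qed

text \<open>Dividing by the positive measure does not affect the direction, so continuity of the
  unnormalised integral suffices.\<close>

lemma central_hemisphere_eq_sgn:
  fixes \<gamma> :: "real \<Rightarrow> 'a::euclidean_space"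
  assumes \<gamma>: "continuous_on {0..1} \<gamma>" "\<And>t. t \<in> {0..1} \<Longrightarrow> norm (\<gamma> t) = 1"
    and ne: "hemispheres_containing \<gamma> \<noteq> {}"
  shows "central_hemisphere \<gamma> = sgn (LINT x:hemispheres_containing \<gamma>|sphere_volume. x)"
proof -
  interpret finite_measure "sphere_volume :: 'a measure" by (rule finite_measure_sphere_volume)
  have "measure sphere_volume (hemispheres_containing \<gamma>) > 0"
    using emeasure_hemispheres_containing_pos[OF assms] by (simp add: emeasure_eq_measure)
  then show ?thesis
    by (simp add: central_hemisphere_def barycenter_def Let_def sgn_div_norm field_simps)
qed

section \<open>From convergent sequences of arcs to the C^r topology\<close>

lemma sphere_arcs_continuous_on: "\<gamma> \<in> sphere_arcs r \<Longrightarrow> continuous_on {0..1} \<gamma>"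
  \<comment> \<open>The case of order 0, where \<open>arc_deriv 0 \<gamma>\<close> is
    \<open>\<gamma>\<close> itself.\<close>
  unfolding sphere_arcs_def Cr_on_unit_interval_def by (auto dest: spec[of _ 0])

lemma sphere_arcs_norm: "\<gamma> \<in> sphere_arcs r \<Longrightarrow> t \<in> {0..1} \<Longrightarrow> norm (\<gamma> t) = 1"
  by (auto simp: sphere_arcs_def PiE_def Pi_def)

lemma mem_hemispherical_arcs_iff:
  "\<gamma> \<in> hemispherical_arcs r \<longleftrightarrow> \<gamma> \<in> sphere_arcs r \<and> hemispheres_containing \<gamma> \<noteq> {}"
proof -
  have "\<gamma> ` {0..1} \<subseteq> open_hemisphere h \<longleftrightarrow> (\<forall>t\<in>{0..1}. h \<bullet> \<gamma> t > 0)"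
    if "\<gamma> \<in> sphere_arcs r" for h
    using sphere_arcs_norm[OF that] by (simp add: open_hemisphere_def image_subset_iff)
  then show ?thesis
    unfolding hemispherical_arcs_def hemispheres_containing_def by blast
qed

text \<open>The approximating arcs are only assumed to lie on the sphere: one fixed hemisphere
  containing \<open>\<gamma>\<close> contains all late arcs as well. Continuity of
  \<open>sgn\<close> away from 0 then gives the limit.\<close>

lemma tendsto_central_hemisphere:
  fixes \<gamma> :: "real \<Rightarrow> 'a::euclidean_space"
  assumes \<gamma>: "\<gamma> \<in> hemispherical_arcs r" and \<eta>: "\<And>k. \<eta> k \<in> sphere_arcs r"
    and lim: "uniform_limit {0..1} \<eta> \<gamma> sequentially"
  shows "(\<lambda>k. central_hemisphere (\<eta> k)) \<longlonglongrightarrow> central_hemisphere \<gamma>"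
    and "\<forall>\<^sub>F k in sequentially. \<eta> k \<in> hemispherical_arcs r"
proof -
  note arc = sphere_arcs_continuous_on sphere_arcs_norm
  have \<gamma>': "\<gamma> \<in> sphere_arcs r" "hemispheres_containing \<gamma> \<noteq> {}"
    using \<gamma> by (auto simp: mem_hemispherical_arcs_iff)
  then obtain x where "x \<in> hemispheres_containing \<gamma>" by blast
  from eventually_mem_hemispheres_containing[OF arc(1)[OF \<gamma>'(1)] this lim]
  show ev: "\<forall>\<^sub>F k in sequentially. \<eta> k \<in> hemispherical_arcs r"
    by eventually_elim (use \<eta> in \<open>auto simp: mem_hemispherical_arcs_iff\<close>)
  have "(\<lambda>k. sgn (LINT x:hemispheres_containing (\<eta> k)|sphere_volume. x))
          \<longlonglongrightarrow> sgn (LINT x:hemispheres_containing \<gamma>|sphere_volume. x)"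
    by (intro tendsto_sgn tendsto_integral_hemispheres_containing
          integral_hemispheres_containing_nonzero arc[OF \<gamma>'(1)] arc[OF \<eta>] \<gamma>'(2) lim)
  \<comment> \<open>The normalisation identity is applied where the set of hemispheres is nonempty,
    which is known for large \<open>k\<close>.\<close>
  moreover have "\<forall>\<^sub>F k in sequentially. sgn (LINT x:hemispheres_containing (\<eta> k)|sphere_volume. x)
                   = central_hemisphere (\<eta> k)"
    using ev
  proof eventually_elim
    case (elim k)
    then have "hemispheres_containing (\<eta> k) \<noteq> {}"
      by (simp add: mem_hemispherical_arcs_iff)
    from central_hemisphere_eq_sgn[OF arc[OF \<eta>] this] show ?case by simp
  qed
  ultimately have "(\<lambda>k. central_hemisphere (\<eta> k))
                    \<longlonglongrightarrow> sgn (LINT x:hemispheres_containing \<gamma>|sphere_volume. x)"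
    by (rule Lim_transform_eventually)
  with central_hemisphere_eq_sgn[OF arc[OF \<gamma>'(1)] \<gamma>'(2)]
  show "(\<lambda>k. central_hemisphere (\<eta> k)) \<longlonglongrightarrow> central_hemisphere \<gamma>" by simp
qed

text \<open>Openness is obtained in the space of all arcs, not just in the subspace, so stability of
  hemispherical arcs is part of the claim. The basic neighbourhoods are metric balls, which permits
  a sequential argument.\<close>

lemma openin_central_hemisphere_vimage:
  fixes V :: "'a::euclidean_space set"
  assumes "open V"
  shows "openin (Cr_topology r) {\<gamma> \<in> hemispherical_arcs r. central_hemisphere \<gamma> \<in> V}"
    (is "openin _ ?T")
  unfolding openin_Cr_topology
proof (intro conjI ballI)
  show "?T \<subseteq> sphere_arcs r" by (auto simp: hemispherical_arcs_def)
next
  fix \<gamma> assume \<gamma>: "\<gamma> \<in> ?T"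
  let ?near = "\<lambda>e \<eta>. \<forall>k\<le>r. \<forall>t\<in>{0..1}. dist (arc_deriv k \<gamma> t) (arc_deriv k \<eta> t) < e"
  show "\<exists>e>0. \<forall>\<eta>\<in>sphere_arcs r. ?near e \<eta> \<longrightarrow> \<eta> \<in> ?T"
  proof (rule ccontr)
    assume "\<not> ?thesis"
    then have far: "\<exists>\<eta>. \<eta> \<in> sphere_arcs r \<and> ?near e \<eta> \<and> \<eta> \<notin> ?T" if "e > 0" for e
      using that by blast
    \<comment> \<open>If no radius works, the radii \<open>1 / real (Suc k)\<close> yield a sequence
      outside \<open>?T\<close> that converges to \<open>\<gamma>\<close>.\<close>
    have "\<exists>\<eta>. \<eta> \<in> sphere_arcs r \<and> ?near (1 / real (Suc k)) \<eta> \<and> \<eta> \<notin> ?T" for k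
      by (rule far) simp
    then have "\<exists>\<eta>. \<forall>k. \<eta> k \<in> sphere_arcs r \<and> ?near (1 / real (Suc k)) (\<eta> k) \<and> \<eta> k \<notin> ?T"
      by (intro choice allI)
    then obtain \<eta> where \<eta>: "\<And>k. \<eta> k \<in> sphere_arcs r"
        "\<And>k. ?near (1 / real (Suc k)) (\<eta> k)" "\<And>k. \<eta> k \<notin> ?T"
      by blast
    \<comment> \<open>Order 0 of C^r closeness is uniform closeness, whatever \<open>r\<close>
      is.\<close>
    have close: "dist (\<eta> k t) (\<gamma> t) < 1 / real (Suc k)" if "t \<in> {0..1}" for k t
      using \<eta>(2)[of k, rule_format, of 0 t] that by (simp add: dist_commute)
    have lim: "uniform_limit {0..1} \<eta> \<gamma> sequentially"
    proof (rule uniform_limitI)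
      fix e :: real assume "e > 0"
      have "\<forall>\<^sub>F k in sequentially. 1 / real (Suc k) < e"
        using order_tendstoD(2)[OF LIMSEQ_inverse_real_of_nat \<open>e > 0\<close>] by (simp add: inverse_eq_divide)
      then show "\<forall>\<^sub>F k in sequentially. \<forall>t\<in>{0..1}. dist (\<eta> k t) (\<gamma> t) < e"
        by eventually_elim (use close in \<open>meson less_trans\<close>)
    qed
    have \<gamma>': "\<gamma> \<in> hemispherical_arcs r" "central_hemisphere \<gamma> \<in> V" using \<gamma> by auto
    have "\<forall>\<^sub>F k in sequentially. \<eta> k \<in> ?T"
      using topological_tendstoD[OF tendsto_central_hemisphere(1)[OF \<gamma>'(1) \<eta>(1) lim] assms \<gamma>'(2)]
        tendsto_central_hemisphere(2)[OF \<gamma>'(1) \<eta>(1) lim]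
      by eventually_elim simp
    from eventually_happens'[OF sequentially_bot this] obtain k where "\<eta> k \<in> ?T" ..
    with \<eta>(3)[of k] show False by contradiction
  qed
qed

lemma central_hemisphere_in_sphere:
  fixes \<gamma> :: "real \<Rightarrow> 'a::euclidean_space"
  assumes "\<gamma> \<in> hemispherical_arcs r"
  shows "central_hemisphere \<gamma> \<in> sphere 0 1"
proof -
  have \<gamma>: "\<gamma> \<in> sphere_arcs r" "hemispheres_containing \<gamma> \<noteq> {}"
    using assms by (simp_all add: mem_hemispherical_arcs_iff)
  note arc = sphere_arcs_continuous_on[OF \<gamma>(1)] sphere_arcs_norm[OF \<gamma>(1)]
  show ?thesis
    using central_hemisphere_eq_sgn[OF arc \<gamma>(2)] integral_hemispheres_containing_nonzero[OF arc \<gamma>(2)]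
    by (simp add: norm_sgn)
qed

theorem mainTheorem18:
  fixes n r :: nat
  assumes "n \<ge> 2"
    and "CARD('m::finite) = n + 1"
  shows "continuous_map
           (subtopology (Cr_topology r) (hemispherical_arcs r))
           (top_of_set (sphere (0 :: real ^ 'm) 1))
           central_hemisphere"
proof -
  have top: "topspace (subtopology (Cr_topology r) (hemispherical_arcs r :: (real \<Rightarrow> real ^ 'm) set))
      = hemispherical_arcs r"
    by (auto simp: hemispherical_arcs_def)
  show ?thesis
    \<comment> \<open>Continuity into the sphere splits into continuity into the ambient space and
      values on the sphere.\<close>
    unfolding continuous_map_in_subtopology
  proof
    show "continuous_map (subtopology (Cr_topology r) (hemispherical_arcs r)) euclidean
            (central_hemisphere :: _ \<Rightarrow> real ^ 'm)"
      unfolding continuous_map_def top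
      \<comment> \<open>The preimage, being open among all arcs, serves as its own witness in the
        subspace topology.\<close>
      by (auto simp: openin_subtopology intro!: exI openin_central_hemisphere_vimage)
    show "central_hemisphere \<in> topspace (subtopology (Cr_topology r) (hemispherical_arcs r))
            \<rightarrow> sphere (0 :: real ^ 'm) 1"
      unfolding top using central_hemisphere_in_sphere by blast
  qed
qed

end
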